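(* Let $D$ be the surface (boundary) of the regular dodecahedron in $\mathbb{R}^3$. There exist a vertex $v$ of $D$ and a straight-line trajectory on $D$ of positive length that starts at $v$, ends at $v$, and does not pass through any other vertex of $D$. Explicitly: there exist a vertex $v$ of $D$, a real number $L>0$, and a unit-speed straight-line trajectory $\gamma:[0,L]\to D$ such that $\gamma(0)=\gamma(L)=v$ and $\gamma(t)$ is not a vertex of $D$ for any $0<t<L$.
   Context: The regular dodecahedron is the Platonic solid with 12 congruent regular pentagonal faces, 30 edges and 20 vertices, three faces meeting at each vertex. Its surface $D$ is the union of its faces. A straight-line trajectory on the surface of a polyhedron is a path that is a straight line segment within each face it meets, and that is extended across an edge in the unique way such that, when the two faces adjacent to that edge are flattened (unfolded isometrically into a common plane, on opposite sides of their common edge), the trajectory forms a straight line in the plane. This extension is well-defined away from the vertices. By choosing a tangent direction at a vertex (pointing into a face or along an edge at that vertex), one obtains the corresponding straight-line trajectory emanating from that vertex, which continues until it first reaches a vertex. Precisely, a unit-speed straight-line trajectory $\gamma:[0,L]\to D$ whose interior points $\gamma(t)$, $0<t<L$, are not vertices is a continuous path satisfying one of the following. Either $\gamma$ runs at unit speed along an edge. Or there are a finite sequence of faces $F_0,\dots,F_n$, consecutive ones $F_{i-1},F_i$ being distinct and sharing an edge $e_i$, times $0=t_0<t_1<\dots<t_{n+1}=L$, and isometric embeddings $\phi_i:F_i\to\mathbb{R}^2$, such that: $\phi_{i-1}$ and $\phi_i$ agree on $e_i$; $\phi_{i-1}(F_{i-1})$ and $\phi_i(F_i)$ lie on opposite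 sides of the line through the image of $e_i$; $\gamma([t_i,t_{i+1}])\subset F_i$; $\gamma(t_i)$ lies in the relative interior of $e_i$ for $1\le i\le n$; and there are $p\in\mathbb{R}^2$ and a unit vector $u\in\mathbb{R}^2$ with $\phi_i(\gamma(t))=p+tu$ for all $i$ and all $t\in[t_i,t_{i+1}]$. *)

theory Defs
  imports "HOL-Analysis.Analysis"
begin

definition golden :: real where
  "golden = (1 + sqrt 5) / 2"

definition dodecahedron_vertices :: "(real^3) set" where
  "dodecahedron_vertices =
     {vector [a, b, c] | a b c. a \<in> {-1, 1} \<and> b \<in> {-1, 1} \<and> c \<in> {-1, 1}} \<union>
     {vector [0, a * golden, b / golden] | a b. a \<in> {-1, 1} \<and> b \<in> {-1, 1}} \<union>
     {vector [b / golden, 0, a * golden] | a b. a \<in> {-1, 1} \<and> b \<in> {-1, 1}} \<union>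
     {vector [a * golden, b / golden, 0] | a b. a \<in> {-1, 1} \<and> b \<in> {-1, 1}}"

text \<open>The regular dodecahedron is unique up to similarity; this is the usual representative
  (centre 0, edge length \<open>2 / golden\<close>) as a solid. Its surface is its \<^const>\<open>frontier\<close>, and its
  faces, edges and vertices are given by \<^const>\<open>facet_of\<close>, \<^const>\<open>edge_of\<close> and
  \<^const>\<open>extreme_point_of\<close>.\<close>

definition dodecahedron :: "(real^3) set" where
  "dodecahedron = convex hull dodecahedron_vertices"

definition isometric_on :: "'a::metric_space set \<Rightarrow> ('a \<Rightarrow> 'b::metric_space) \<Rightarrow> bool" where
  "isometric_on S f \<longleftrightarrow> (\<forall>x\<in>S. \<forall>y\<in>S. dist (f x) (f y) = dist x y)"

definition opposite_sides :: "(real^2) set \<Rightarrow> (real^2) set \<Rightarrow> (real^2) set \<Rightarrow> bool" where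
  "opposite_sides l S T \<longleftrightarrow>
     (\<exists>a b. a \<noteq> 0 \<and> l = {x. a \<bullet> x = b} \<and> S \<subseteq> {x. a \<bullet> x \<le> b} \<and> T \<subseteq> {x. a \<bullet> x \<ge> b})"

definition runs_along_edge :: "(real^3) set \<Rightarrow> real \<Rightarrow> (real \<Rightarrow> real^3) \<Rightarrow> bool" where
  "runs_along_edge P L \<gamma> \<longleftrightarrow>
     (\<exists>e p u. e edge_of P \<and> norm u = 1 \<and> (\<forall>t\<in>{0..L}. \<gamma> t \<in> e \<and> \<gamma> t = p + t *\<^sub>R u))"

text \<open>The path meets the faces \<open>F 0, \<dots>, F n\<close> in turn, crosses the edge \<open>e i\<close> from
  \<open>F (i - 1)\<close> to \<open>F i\<close> at time \<open>\<tau> i\<close>, and the maps \<open>\<phi> i\<close> unfold the faces into a common plane;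
  only the values of \<open>\<phi> i\<close> on \<open>F i\<close> matter.\<close>

definition unfolds_to_line :: "(real^3) set \<Rightarrow> real \<Rightarrow> (real \<Rightarrow> real^3) \<Rightarrow> bool" where
  "unfolds_to_line P L \<gamma> \<longleftrightarrow>
     (\<exists>(n::nat) (F :: nat \<Rightarrow> (real^3) set) (e :: nat \<Rightarrow> (real^3) set) (\<tau> :: nat \<Rightarrow> real)
        (\<phi> :: nat \<Rightarrow> real^3 \<Rightarrow> real^2) (p :: real^2) (u :: real^2).
        (\<forall>i\<le>n. F i facet_of P) \<and>
        (\<forall>i\<in>{1..n}. F (i - 1) \<noteq> F i \<and> e i edge_of P \<and> e i \<subseteq> F (i - 1) \<inter> F i) \<and>
        \<tau> 0 = 0 \<and> \<tau> (n + 1) = L \<and> (\<forall>i\<le>n. \<tau> i < \<tau> (i + 1)) \<and>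
        (\<forall>i\<le>n. isometric_on (F i) (\<phi> i)) \<and>
        (\<forall>i\<in>{1..n}. (\<forall>x\<in>e i. \<phi> (i - 1) x = \<phi> i x) \<and>
           opposite_sides (affine hull (\<phi> i ` e i)) (\<phi> (i - 1) ` F (i - 1)) (\<phi> i ` F i)) \<and>
        (\<forall>i\<le>n. \<gamma> ` {\<tau> i..\<tau> (i + 1)} \<subseteq> F i) \<and>
        (\<forall>i\<in>{1..n}. \<gamma> (\<tau> i) \<in> rel_interior (e i)) \<and>
        norm u = 1 \<and>
        (\<forall>i\<le>n. \<forall>t\<in>{\<tau> i..\<tau> (i + 1)}. \<phi> i (\<gamma> t) = p + t *\<^sub>R u))"

definition straight_line_trajectory :: "(real^3) set \<Rightarrow> real \<Rightarrow> (real \<Rightarrow> real^3) \<Rightarrow> bool" where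
  "straight_line_trajectory P L \<gamma> \<longleftrightarrow>
     continuous_on {0..L} \<gamma> \<and> \<gamma> ` {0..L} \<subseteq> frontier P \<and>
     (runs_along_edge P L \<gamma> \<or> unfolds_to_line P L \<gamma>)"

end

theory Submission imports Defs begin

text \<open>
  A path on the surface of a convex polyhedron can be tested for straightness without unfolding
  anything. Let it leave a face with outer normal \<open>N\<close> in direction \<open>d\<close> and continue in the adjacent
  face, whose outer normal \<open>N'\<close> has the same length, in direction \<open>d'\<close>. Flattening the second face
  into the plane of the first is a rotation about the common edge that carries \<open>N'\<close> to \<open>N\<close>, and
  such a rotation changes every vector tangent to the second face by a multiple of the bisecting
  normal \<open>N + N'\<close>. So the path is straight after unfolding exactly when \<open>d' - d\<close> is a multiple of
  \<open>N + N'\<close>: it bends only in the direction normal to the surface.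

  The lemma \<open>bending_polygon_is_trajectory\<close> turns this into a criterion for spatial polygons. The
  face maps it uses put the direction of travel on the first coordinate axis: a point \<open>y\<close> of the
  \<open>i\<close>-th face is sent to its coordinates along \<open>d\<close> and along \<open>N \<times> d\<close>, relative to the current point
  of the path, with the first one shifted by the time. The whole path then runs along that axis, and
  the bending condition says precisely that consecutive maps agree on the common edge
  (\<open>unfolding_charts_agree\<close>) and place the two faces on opposite sides of it
  (\<open>opposite_sides_unfolding_charts\<close>). That the pieces really are facets and edges also comes
  from the path itself, through a chain of strictly increasing dimensions (\<open>adjacent_facets\<close>).

  What is left is one closed polygon. Unfold seven faces of the dodecahedron in a suitable order,
  starting with a face at the vertex \<open>(1, 1, -1)\<close>. The last of them has a corner that represents the
  same vertex, and the segment between the two copies passes through the interiors of the six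
  unfolded common edges. Its displacement, in the plane of the first face, is
  \<open>(-golden, 1, 5 + 3 * golden)\<close>. All coordinates of the folded path lie in the field generated by
  \<open>golden\<close>, so every hypothesis of the criterion reduces to arithmetic with
  \<open>golden * golden = golden + 1\<close> and a rational enclosure of \<open>golden\<close>.
\<close>

unbundle cross3_syntax

section \<open>Piecewise linear paths\<close>

lemma piecewise_linear_path:
  fixes x d :: "nat \<Rightarrow> 'a::real_normed_vector" and \<tau> :: "nat \<Rightarrow> real"
  assumes "\<And>i. i \<le> n \<Longrightarrow> \<tau> i < \<tau> (Suc i)"
    and "\<And>i. i \<le> n \<Longrightarrow> x (Suc i) = x i + (\<tau> (Suc i) - \<tau> i) *\<^sub>R d i"
  shows "\<exists>\<gamma>. continuous_on {\<tau> 0..\<tau> (Suc n)} \<gamma> \<and>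
    (\<forall>i\<le>n. \<forall>t\<in>{\<tau> i..\<tau> (Suc i)}. \<gamma> t = x i + (t - \<tau> i) *\<^sub>R d i)"
  using assms
proof (induction n)
  case 0
  have "continuous_on {\<tau> 0..\<tau> (Suc 0)} (\<lambda>t. x 0 + (t - \<tau> 0) *\<^sub>R d 0)"
    by (intro continuous_intros)
  then show ?case by auto
next
  case (Suc n)
  obtain \<gamma> where cont: "continuous_on {\<tau> 0..\<tau> (Suc n)} \<gamma>"
    and \<gamma>: "\<And>i t. i \<le> n \<Longrightarrow> \<tau> i \<le> t \<Longrightarrow> t \<le> \<tau> (Suc i) \<Longrightarrow> \<gamma> t = x i + (t - \<tau> i) *\<^sub>R d i"
    using Suc.IH Suc.prems by force
  let ?s = "\<tau> (Suc n)"
  have le: "\<tau> (Suc i) \<le> ?s" if "i \<le> n" for i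
  proof -
    note step = Suc.prems(1)
    have "k \<le> n \<Longrightarrow> i \<le> k \<longrightarrow> \<tau> (Suc i) \<le> \<tau> (Suc k)" for k
    proof (induction k)
      case (Suc k)
      then show ?case using step[of "Suc k"] by (auto simp: le_Suc_eq)
    qed simp
    then show ?thesis using that by simp
  qed
  have "\<tau> 0 < \<tau> (Suc 0)" using Suc.prems(1)[of 0] by simp
  then have le0: "\<tau> 0 \<le> ?s" using le[of 0] by linarith
  define \<delta> where "\<delta> t = (if t \<le> ?s then \<gamma> t else x (Suc n) + (t - ?s) *\<^sub>R d (Suc n))" for t
  have end_eq: "\<gamma> ?s = x (Suc n)"
    using \<gamma>[of n ?s] Suc.prems(1)[of n] Suc.prems(2)[of n] by simp
  have "{\<tau> 0..\<tau> (Suc (Suc n))} = {\<tau> 0..?s} \<union> {?s..\<tau> (Suc (Suc n))}"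
    using le0 Suc.prems(1)[of "Suc n"] by auto
  moreover have "continuous_on ({\<tau> 0..?s} \<union> {?s..\<tau> (Suc (Suc n))}) \<delta>"
    unfolding \<delta>_def
    by (rule continuous_on_cases) (use cont end_eq in \<open>auto intro!: continuous_intros\<close>)
  ultimately have "continuous_on {\<tau> 0..\<tau> (Suc (Suc n))} \<delta>" by simp
  moreover have "\<delta> t = x i + (t - \<tau> i) *\<^sub>R d i"
    if "i \<le> Suc n" "\<tau> i \<le> t" "t \<le> \<tau> (Suc i)" for i t
  proof (cases "i \<le> n")
    case True
    then show ?thesis using \<gamma>[of i t] le[of i] that by (simp add: \<delta>_def)
  next
    case False
    then have "i = Suc n" using that by simp
    then show ?thesis using that end_eq by (auto simp: \<delta>_def)
  qed
  ultimately show ?case by auto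
qed

lemma covering_interval:
  fixes \<tau> :: "nat \<Rightarrow> real"
  assumes "\<tau> 0 \<le> t" "t < \<tau> (Suc n)"
  obtains i where "i \<le> n" "\<tau> i \<le> t" "t < \<tau> (Suc i)"
  using assms
proof (induction n arbitrary: thesis)
  case (Suc n)
  show ?case
  proof (cases "t < \<tau> (Suc n)")
    case True
    then show ?thesis using Suc.IH Suc.prems(1,2) le_SucI by metis
  next
    case False
    then show ?thesis using Suc.prems(1)[of "Suc n"] Suc.prems(3) by simp
  qed
qed auto

section \<open>Unfolding a face along a direction of travel\<close>

text \<open>The vectors \<open>d\<close> and \<open>N \<times> d\<close> form an orthogonal basis of the plane normal to \<open>N\<close>. Only \<open>y\<close> has to
  lie in that plane; taking for \<open>z\<close> the normal of an adjacent face expresses the side of the common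
  edge in the coordinates of the chart below.\<close>

lemma tangent_plane_expansion:
  fixes N d y z :: "real^3"
  assumes "N \<bullet> d = 0" "N \<bullet> y = 0" "N \<noteq> 0" "d \<noteq> 0"
  shows "y \<bullet> z = (d \<bullet> y) * (d \<bullet> z) / (norm d)\<^sup>2 +
    ((N \<times> d) \<bullet> y) * ((N \<times> d) \<bullet> z) / (norm N * norm d)\<^sup>2"
proof -
  have "(N \<bullet> N) * (d \<bullet> d) * (y \<bullet> z) =
    (N \<bullet> N) * (d \<bullet> y) * (d \<bullet> z) + ((N \<times> d) \<bullet> y) * ((N \<times> d) \<bullet> z)"
    using assms(1,2) unfolding cross3_def inner_vec_def sum_3 by (simp, algebra)
  then show ?thesis
    using assms(3,4) by (simp add: power_mult_distrib power2_norm_eq_inner field_simps)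
qed

text \<open>The time coordinate \<open>t\<close> is the time at which the path is at \<open>x\<close>; for \<open>d\<close> tangent to
  the face, the denominators are the lengths of \<open>d\<close> and \<open>N \<times> d\<close>.\<close>

definition unfolding_chart :: "real^3 \<Rightarrow> real^3 \<Rightarrow> real^3 \<Rightarrow> real \<Rightarrow> real^3 \<Rightarrow> real^2" where
  "unfolding_chart N d x t y =
     vector [t + d \<bullet> (y - x) / norm d, (N \<times> d) \<bullet> (y - x) / (norm N * norm d)]"

lemma isometric_on_unfolding_chart:
  assumes "N \<bullet> d = 0" "N \<noteq> 0" "d \<noteq> 0"
  shows "isometric_on {y. N \<bullet> y = c} (unfolding_chart N d x t)"
  unfolding isometric_on_def
proof (intro ballI)
  fix y z assume yz: "y \<in> {y. N \<bullet> y = c}" "z \<in> {y. N \<bullet> y = c}"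
  let ?f = "unfolding_chart N d x t"
  have N: "N \<bullet> (y - z) = 0" using yz by (simp add: inner_diff_right)
  have "?f y - ?f z = vector [d \<bullet> (y - z) / norm d, (N \<times> d) \<bullet> (y - z) / (norm N * norm d)]"
    by (simp add: unfolding_chart_def vec_eq_iff forall_2 inner_diff_right flip: diff_divide_distrib)
  then have "(?f y - ?f z) \<bullet> (?f y - ?f z) =
      (d \<bullet> (y - z))\<^sup>2 / (norm d)\<^sup>2 + ((N \<times> d) \<bullet> (y - z))\<^sup>2 / (norm N * norm d)\<^sup>2"
    by (simp add: inner_vec_def sum_2 power2_eq_square)
  also have "\<dots> = (y - z) \<bullet> (y - z)"
    using tangent_plane_expansion[OF assms(1) N assms(2,3), of "y - z"]
    by (simp add: power2_eq_square)
  finally show "dist (?f y) (?f z) = dist y z"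
    by (simp add: dist_norm norm_eq_sqrt_inner)
qed

text \<open>A chart does not depend on which point of the path it is based at, so the charts of two adjacent
  faces may both be based at the crossing point.\<close>

lemma unfolding_chart_rebase:
  assumes "d \<noteq> 0"
  shows "unfolding_chart N d (x + s *\<^sub>R d) (t + s * norm d) = unfolding_chart N d x t"
proof -
  have "d \<bullet> d / norm d = norm d"
    using assms by (simp add: dot_square_norm power2_eq_square)
  then show ?thesis
    by (simp add: fun_eq_iff unfolding_chart_def inner_diff_right inner_add_right dot_cross_self
        diff_divide_distrib add_divide_distrib algebra_simps flip: times_divide_eq_right)
qed

lemma unfolding_chart_base: "unfolding_chart N d x t x = vector [t, 0]"
  by (simp add: unfolding_chart_def)

section \<open>Crossing an edge\<close>

text \<open>Tangency of \<open>d'\<close> to the second face gives \<open>N' \<bullet> d = \<alpha> * (N \<bullet> N + N \<bullet> N')\<close>, whose right-hand side is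
  symmetric in the two faces. Hence the crossing has a symmetry that exchanges them: the speed is
  preserved, and the direction in each face has, up to sign, the same component along the normal
  of the other.\<close>

lemma bending_identities:
  fixes N N' d d' :: "real^3"
  assumes "norm N' = norm N" "N \<bullet> d = 0" "N' \<bullet> d' = 0" "d' = d - \<alpha> *\<^sub>R (N + N')"
  shows "norm d' = norm d" "N \<bullet> d' = - (N' \<bullet> d)"
    "N \<bullet> (N' \<times> d') = - (N' \<bullet> (N \<times> d))"
proof -
  have NN: "N' \<bullet> N' = N \<bullet> N" using assms(1) by (simp add: norm_eq)
  have \<alpha>: "N' \<bullet> d = \<alpha> * (N' \<bullet> N + N \<bullet> N)"
    using assms(3,4) NN by (simp add: inner_diff_right inner_add_right)
  then show 2: "N \<bullet> d' = - (N' \<bullet> d)"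
    unfolding assms(4) using assms(2)
    by (simp add: inner_diff_right inner_add_right inner_commute algebra_simps)
  have "d' \<bullet> d' - d \<bullet> d = (d' - d) \<bullet> (d' + d)"
    by (simp add: inner_diff_left inner_diff_right inner_add_right inner_commute)
  also have "d' - d = (- \<alpha>) *\<^sub>R (N + N')"
    by (simp add: assms(4))
  also have "\<dots> \<bullet> (d' + d) = - \<alpha> * (N \<bullet> d' + N \<bullet> d + N' \<bullet> d' + N' \<bullet> d)"
    by (simp add: inner_add_left inner_add_right ring_distribs)
  finally have "d' \<bullet> d' = d \<bullet> d" using 2 assms(2,3) by simp
  then show "norm d' = norm d" by (simp add: norm_eq)
  show "N \<bullet> (N' \<times> d') = - (N' \<bullet> (N \<times> d))"
    unfolding assms(4) cross3_def inner_vec_def sum_3 by (simp add: algebra_simps)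
qed

text \<open>The edge direction is \<open>N \<times> N'\<close>; multiplying by its square length avoids a division and covers the
  degenerate case.\<close>

lemma common_edge_collinear:
  fixes N N' y :: "real^3"
  assumes "N \<bullet> y = 0" "N' \<bullet> y = 0"
  shows "((N \<times> N') \<bullet> (N \<times> N')) *\<^sub>R y = ((N \<times> N') \<bullet> y) *\<^sub>R (N \<times> N')"
  using assms unfolding cross3_def inner_vec_def sum_3 vec_eq_iff forall_3
  by (simp, intro conjI; algebra)

text \<open>The first coordinates agree because \<open>d - d'\<close> is normal to the edge. For the second ones it suffices
  to compare \<open>N \<times> d\<close> and \<open>N' \<times> d'\<close> along the edge direction, that is,
  their inner products with \<open>N \<times> N'\<close>, which are both \<open>(N \<bullet> N) * (N' \<bullet> d)\<close>.\<close>

lemma unfolding_charts_agree: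
  fixes N N' d d' x y :: "real^3"
  assumes "norm N' = norm N" "N \<bullet> d = 0" "N' \<bullet> d' = 0" "d' = d - \<alpha> *\<^sub>R (N + N')"
    and pos: "N' \<bullet> d > 0"
    and y: "N \<bullet> (y - x) = 0" "N' \<bullet> (y - x) = 0"
  shows "unfolding_chart N' d' x t y = unfolding_chart N d x t y"
proof -
  let ?y = "y - x" and ?e = "N \<times> N'"
  note bend = bending_identities[OF assms(1-4)]
  have NN: "N' \<bullet> N' = N \<bullet> N" using assms(1) by (simp add: norm_eq)
  have "d' \<bullet> ?y = d \<bullet> ?y"
    using y by (simp add: assms(4) inner_diff_left inner_add_left)
  moreover have "(N' \<times> d') \<bullet> ?y = (N \<times> d) \<bullet> ?y"
  proof -
    \<comment> \<open>Parallel normals are excluded: \<open>d\<close> is tangent to the first face but not to the second.\<close>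
    have "?e \<noteq> 0"
    proof
      assume e0: "?e = 0"
      have "(N \<bullet> N) *\<^sub>R N' = (N \<bullet> N') *\<^sub>R N + ?e \<times> N"
        unfolding cross3_def inner_vec_def sum_3 vec_eq_iff forall_3 by (simp add: algebra_simps)
      then have "(N \<bullet> N) * (N' \<bullet> d) = 0"
        using assms(2) e0 by (metis add.right_neutral cross_zero_left inner_scaleR_left mult_zero_right)
      then have "N = 0" using pos by simp
      then show False using NN pos by simp
    qed
    moreover have "(?e \<bullet> ?e) * ((N' \<times> d') \<bullet> ?y) = (?e \<bullet> ?e) * ((N \<times> d) \<bullet> ?y)"
    proof -
      have "(N' \<times> d') \<bullet> ?e = (N' \<bullet> N) * (d' \<bullet> N') - (N' \<bullet> N') * (d' \<bullet> N)"
        and "(N \<times> d) \<bullet> ?e = (N \<bullet> N) * (d \<bullet> N') - (N \<bullet> N') * (d \<bullet> N)"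
        unfolding cross3_def inner_vec_def sum_3 by (simp_all add: algebra_simps)
      then have "((N' \<times> d') - (N \<times> d)) \<bullet> ?e = 0"
        using NN assms(2,3) bend(2) by (simp add: inner_diff_left inner_diff_right inner_commute)
      then have "((N' \<times> d') - (N \<times> d)) \<bullet> ((?e \<bullet> ?e) *\<^sub>R ?y) = 0"
        unfolding common_edge_collinear[OF y] by simp
      then show ?thesis by (simp add: inner_diff_left right_diff_distrib)
    qed
    ultimately show ?thesis by simp
  qed
  ultimately show ?thesis
    using bend(1) assms(1) by (simp add: unfolding_chart_def)
qed

text \<open>In the chart of the first face the function \<open>N' \<bullet> y - c\<close>, which is nonpositive on the body, becomes
  affine with some gradient \<open>a\<close>. In the chart of the second face \<open>N \<bullet> y - c\<close> has gradient \<open>-a\<close>, by the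
  symmetry of the crossing. Hence the line where the first function vanishes separates the two
  images, and it is spanned by the image of the edge.\<close>

lemma opposite_sides_unfolding_charts:
  fixes N N' d d' x y :: "real^3"
  assumes "norm N' = norm N" "N \<bullet> d = 0" "N' \<bullet> d' = 0" "d' = d - \<alpha> *\<^sub>R (N + N')"
    and pos: "N' \<bullet> d > 0"
    and F: "F \<subseteq> {y. N \<bullet> y = c \<and> N' \<bullet> y \<le> c}" and F': "F' \<subseteq> {y. N' \<bullet> y = c \<and> N \<bullet> y \<le> c}"
    and E: "E \<subseteq> F \<inter> F'" and x: "x \<in> E" and dim: "aff_dim E = 1"
  shows "opposite_sides (affine hull (unfolding_chart N' d' x t ` E))
    (unfolding_chart N d x t ` F) (unfolding_chart N' d' x t ` F')"
proof -
  let ?f = "unfolding_chart N d x t" and ?f' = "unfolding_chart N' d' x t"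
  note bend = bending_identities[OF assms(1-4)]
  have nz: "N \<noteq> 0" "d \<noteq> 0" "N' \<noteq> 0" "d' \<noteq> 0"
    using pos assms(1) bend(1) by auto
  define a :: "real^2" where
    "a = vector [N' \<bullet> d / norm d, N' \<bullet> (N \<times> d) / (norm N * norm d)]"
  have a': "a = - vector [N \<bullet> d' / norm d', N \<bullet> (N' \<times> d') / (norm N' * norm d')]"
    using bend assms(1) by (simp add: a_def vec_eq_iff forall_2)
  have xc: "N \<bullet> x = c" "N' \<bullet> x = c" using E F F' x by auto
  have "a \<noteq> 0"
    using pos nz by (auto simp: a_def vec_eq_iff forall_2)
  have side: "a \<bullet> ?f y = a \<bullet> vector [t, 0] + (N' \<bullet> y - c)" if "N \<bullet> y = c" for y
  proof -
    have "N \<bullet> (y - x) = 0" using that xc by (simp add: inner_diff_right)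
    from tangent_plane_expansion[OF assms(2) this nz(1,2), of N'] show ?thesis
      using xc by (simp add: a_def unfolding_chart_def inner_vec_def[where 'a=real and 'b=2] sum_2
          inner_diff_right inner_commute power2_eq_square diff_divide_distrib algebra_simps)
  qed
  have side': "a \<bullet> ?f' y = a \<bullet> vector [t, 0] - (N \<bullet> y - c)" if "N' \<bullet> y = c" for y
  proof -
    have "N' \<bullet> (y - x) = 0" using that xc by (simp add: inner_diff_right)
    from tangent_plane_expansion[OF assms(3) this nz(3,4), of N] show ?thesis
      using xc by (simp add: a' unfolding_chart_def inner_vec_def[where 'a=real and 'b=2] sum_2
          inner_diff_right inner_commute power2_eq_square diff_divide_distrib algebra_simps)
  qed
  let ?l = "{z. a \<bullet> z = a \<bullet> vector [t, 0]}"
  have "affine hull (?f' ` E) = ?l"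
  proof (rule affine_dim_equal)
    have sub: "?f' ` E \<subseteq> ?l" using side' E F F' by fastforce
    then show "affine hull (?f' ` E) \<subseteq> ?l"
      by (intro hull_minimal affine_hyperplane)
    obtain y where y: "y \<in> E" "y \<noteq> x"
      using dim x by (metis aff_dim_sing insert_absorb is_singletonI' is_singleton_the_elem
          singletonD zero_neq_one)
    have "dist (?f' y) (?f' x) = dist y x"
      using isometric_on_unfolding_chart[OF assms(3) nz(3,4), of c] y x E F'
      unfolding isometric_on_def by blast
    then have "?f' y \<noteq> ?f' x" using y by auto
    then have "aff_dim {?f' y, ?f' x} = 1" by simp
    then have "1 \<le> aff_dim (?f' ` E)"
      using aff_dim_subset[of "{?f' y, ?f' x}" "?f' ` E"] x y by auto
    moreover have "aff_dim (?f' ` E) \<le> aff_dim ?l" using sub by (rule aff_dim_subset)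
    moreover have "aff_dim ?l = 1" using \<open>a \<noteq> 0\<close> by (simp add: aff_dim_hyperplane)
    ultimately show "aff_dim (affine hull (?f' ` E)) = aff_dim ?l" by simp
    show "affine hull (?f' ` E) \<noteq> {}" using x by auto
  qed (auto simp: affine_hyperplane)
  moreover have "?f ` F \<subseteq> {z. a \<bullet> z \<le> a \<bullet> vector [t, 0]}" using side F by fastforce
  moreover have "?f' ` F' \<subseteq> {z. a \<bullet> z \<ge> a \<bullet> vector [t, 0]}" using side' F' by fastforce
  ultimately show ?thesis
    unfolding opposite_sides_def using \<open>a \<noteq> 0\<close> by blast
qed

section \<open>Facets and edges from supporting planes\<close>

text \<open>The dimensions of \<open>F \<inter> F'\<close>, of either face and of \<open>P\<close> increase strictly, start at 1 or more because of
  \<open>a\<close> and \<open>b\<close>, and end at 3 or less, so they are 1, 2 and 3.\<close>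

lemma adjacent_facets:
  fixes P :: "(real^3) set"
  assumes "convex P" and N: "\<And>y. y \<in> P \<Longrightarrow> N \<bullet> y \<le> c" and N': "\<And>y. y \<in> P \<Longrightarrow> N' \<bullet> y \<le> c"
    and F_def: "F = P \<inter> {y. N \<bullet> y = c}" and F'_def: "F' = P \<inter> {y. N' \<bullet> y = c}"
    and ab: "a \<in> F \<inter> F'" "b \<in> F \<inter> F'" "a \<noteq> b"
    and pq: "p \<in> F - F'" "q \<in> F' - F"
  shows "F facet_of P" "F' facet_of P" "(F \<inter> F') edge_of P"
proof -
  have F: "F face_of P" and F': "F' face_of P"
    unfolding F_def F'_def using assms(1) N N'
    by (simp_all add: face_of_Int_supporting_hyperplane_le)
  then have E: "(F \<inter> F') face_of P" by (rule face_of_Int)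
  have "(F \<inter> F') face_of F" "(F \<inter> F') face_of F'"
    using face_of_subset[OF E _ face_of_imp_subset[OF F]]
      face_of_subset[OF E _ face_of_imp_subset[OF F']] by auto
  moreover have "F \<inter> F' \<noteq> F" "F \<inter> F' \<noteq> F'" "F \<noteq> P" "F' \<noteq> P"
    using pq by (auto simp: F_def F'_def)
  ultimately have "aff_dim (F \<inter> F') < aff_dim F" "aff_dim (F \<inter> F') < aff_dim F'"
    "aff_dim F < aff_dim P" "aff_dim F' < aff_dim P"
    using F F' assms(1) by (simp_all add: face_of_aff_dim_lt face_of_imp_convex)
  moreover have "1 \<le> aff_dim (F \<inter> F')"
    using aff_dim_subset[of "{a, b}" "F \<inter> F'"] ab by auto
  moreover have "aff_dim P \<le> 3" using aff_dim_le_DIM[of P] by simp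
  ultimately have "aff_dim (F \<inter> F') = 1" "aff_dim F = aff_dim P - 1" "aff_dim F' = aff_dim P - 1"
    by auto
  then show "F facet_of P" "F' facet_of P" "(F \<inter> F') edge_of P"
    using E F F' ab by (auto simp: facet_of_def edge_of_def)
qed

lemma rel_interior_of_edge:
  fixes E :: "'a::euclidean_space set"
  assumes "convex E" "aff_dim E = 1" "a \<in> E" "b \<in> E" "x \<in> open_segment a b"
  shows "x \<in> rel_interior E"
proof -
  have "a \<noteq> b" using assms(5) by auto
  have sub: "closed_segment a b \<subseteq> E" using assms by (simp add: closed_segment_subset)
  have "affine hull (closed_segment a b) = affine hull E"
  proof (rule affine_dim_equal)
    show "affine hull (closed_segment a b) \<subseteq> affine hull E" using sub by (rule hull_mono)
    show "aff_dim (affine hull (closed_segment a b)) = aff_dim (affine hull E)"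
      using assms(2) \<open>a \<noteq> b\<close> by (simp add: segment_convex_hull)
  qed auto
  then have "rel_interior (closed_segment a b) \<subseteq> rel_interior E"
    using sub by (intro subset_rel_interior) auto
  then show ?thesis using assms(5) \<open>a \<noteq> b\<close> by (auto simp: rel_interior_closed_segment)
qed

section \<open>Polygons that bend along the surface normals\<close>

text \<open>The vertices of the polygon are \<open>x 0, \<dots>, x (Suc n)\<close>; the segment from \<open>x i\<close> to \<open>x (Suc i)\<close> has direction
  \<open>d i\<close> and lies in the face with outer normal \<open>N i\<close>, and \<open>x (Suc i)\<close> lies between the points \<open>a i\<close> and
  \<open>b i\<close> of the edge where the faces \<open>i\<close> and \<open>Suc i\<close> meet. The directions all have the same length \<open>s\<close>,
  which need not be 1, so that data in a field without square roots can be used; the trajectory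
  reaches \<open>x i\<close> at time \<open>T i * s\<close>. No point strictly between the ends is extreme, since each one is
  interior to a segment in \<open>P\<close>: to a segment of the path, or to the edge being crossed.\<close>

lemma bending_polygon_is_trajectory:
  fixes P :: "(real^3) set" and N x d a b :: "nat \<Rightarrow> real^3" and T :: "nat \<Rightarrow> real"
  assumes P: "convex P" and n: "0 < n"
    and support: "\<And>i y. i \<le> n \<Longrightarrow> y \<in> P \<Longrightarrow> N i \<bullet> y \<le> c"
    and norm_N: "\<And>i. i < n \<Longrightarrow> norm (N (Suc i)) = norm (N i)"
    and tangent: "\<And>i. i \<le> n \<Longrightarrow> N i \<bullet> d i = 0"
    and bend: "\<And>i. i < n \<Longrightarrow> \<exists>\<alpha>. d (Suc i) = d i - \<alpha> *\<^sub>R (N i + N (Suc i))"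
    and towards: "\<And>i. i < n \<Longrightarrow> N (Suc i) \<bullet> d i > 0"
    and T0: "T 0 = 0" and T_less: "\<And>i. i \<le> n \<Longrightarrow> T i < T (Suc i)"
    and step: "\<And>i. i \<le> n \<Longrightarrow> x (Suc i) = x i + (T (Suc i) - T i) *\<^sub>R d i"
    and first: "x 0 \<in> P" "N 0 \<bullet> x 0 = c" and last: "x (Suc n) \<in> P"
    and a: "\<And>i. i < n \<Longrightarrow> a i \<in> P \<and> N i \<bullet> a i = c \<and> N (Suc i) \<bullet> a i = c"
    and b: "\<And>i. i < n \<Longrightarrow> b i \<in> P \<and> N i \<bullet> b i = c \<and> N (Suc i) \<bullet> b i = c"
    and x: "\<And>i. i < n \<Longrightarrow> x (Suc i) \<in> open_segment (a i) (b i)"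
  shows "\<exists>L \<gamma>. L > 0 \<and> straight_line_trajectory P L \<gamma> \<and> \<gamma> 0 = x 0 \<and> \<gamma> L = x (Suc n) \<and>
    (\<forall>t. 0 < t \<and> t < L \<longrightarrow> \<not> \<gamma> t extreme_point_of P)"
proof -
  define F where "F i = P \<inter> {y. N i \<bullet> y = c}" for i
  have convF: "convex (F i)" for i
    using P by (simp add: F_def convex_Int convex_hyperplane)
  have abF: "a i \<in> F i \<inter> F (Suc i)" "b i \<in> F i \<inter> F (Suc i)" "a i \<noteq> b i" if "i < n" for i
  proof -
    show "a i \<in> F i \<inter> F (Suc i)" "b i \<in> F i \<inter> F (Suc i)"
      using a[OF that] b[OF that] by (simp_all add: F_def)
    show "a i \<noteq> b i" using x[OF that] by auto
  qed
  have xE: "x (Suc i) \<in> F i \<inter> F (Suc i)" if "i < n" for i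
    using closed_segment_subset[OF abF(1,2)[OF that] convex_Int[OF convF convF]] x[OF that]
    by (meson segment_open_subset_closed subsetD)
  have xF: "x i \<in> F i" if "i \<le> n" for i
  proof (cases i)
    case 0
    then show ?thesis using first by (simp add: F_def)
  next
    case (Suc j)
    then show ?thesis using xE[of j] that by simp
  qed
  have xF': "x (Suc i) \<in> F i" if "i \<le> n" for i
  proof (cases "i = n")
    case True
    then show ?thesis
      using xF[of n] step[of n] tangent[of n] last by (simp add: F_def inner_add_right)
  next
    case False
    then show ?thesis using that xE[of i] by simp
  qed

  have norm_d_Suc: "norm (d (Suc i)) = norm (d i)" and leaving: "N i \<bullet> d (Suc i) < 0" if "i < n" for i
  proof -
    obtain \<alpha> where "d (Suc i) = d i - \<alpha> *\<^sub>R (N i + N (Suc i))" using bend[OF \<open>i < n\<close>] ..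
    with bending_identities[OF norm_N[OF that] _ _ this] tangent[of i] tangent[of "Suc i"]
      towards[OF that] that
    show "norm (d (Suc i)) = norm (d i)" "N i \<bullet> d (Suc i) < 0" by auto
  qed
  define s where "s = norm (d 0)"
  have norm_d: "norm (d i) = s" if "i \<le> n" for i
    using that by (induction i) (auto simp: s_def norm_d_Suc)
  have "d 0 \<noteq> 0" using towards[of 0] n by auto
  then have s: "s > 0" by (simp add: s_def)
  have d_nz: "d i \<noteq> 0" if "i \<le> n" for i using norm_d[OF that] s by auto
  have N_nz: "N i \<noteq> 0" if "i \<le> n" for i
  proof (cases i)
    case 0
    then show ?thesis using towards[of 0] norm_N[of 0] n by auto
  next
    case (Suc j)
    then show ?thesis using towards[of j] that by auto
  qed

  have facets: "F i facet_of P" "F (Suc i) facet_of P" "(F i \<inter> F (Suc i)) edge_of P"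
    and F_neq: "F i \<noteq> F (Suc i)" if "i < n" for i
  proof -
    have "N (Suc i) \<bullet> x (Suc i) = N (Suc i) \<bullet> x i + (T (Suc i) - T i) * (N (Suc i) \<bullet> d i)"
      using step[of i] that by (simp add: inner_add_right)
    moreover have "(T (Suc i) - T i) * (N (Suc i) \<bullet> d i) > 0"
      using T_less[of i] towards[OF that] that by simp
    \<comment> \<open>The neighbouring vertices of the path witness that the two faces differ from their edge.\<close>
    ultimately have p: "x i \<in> F i - F (Suc i)"
      using xE[OF that] xF[of i] that by (auto simp: F_def)
    have "N i \<bullet> x (Suc (Suc i)) = N i \<bullet> x (Suc i) + (T (Suc (Suc i)) - T (Suc i)) * (N i \<bullet> d (Suc i))"
      using step[of "Suc i"] that by (simp add: inner_add_right)
    moreover have "(T (Suc (Suc i)) - T (Suc i)) * (N i \<bullet> d (Suc i)) < 0"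
      using T_less[of "Suc i"] leaving[OF that] that by (simp add: mult_pos_neg)
    ultimately have q: "x (Suc (Suc i)) \<in> F (Suc i) - F i"
      using xE[OF that] xF'[of "Suc i"] that by (auto simp: F_def)
    show "F i facet_of P" "F (Suc i) facet_of P" "(F i \<inter> F (Suc i)) edge_of P"
      using adjacent_facets[OF P _ _ F_def F_def abF[OF that] p q] support[of i] support[of "Suc i"] that
      by simp_all
    show "F i \<noteq> F (Suc i)" using p by auto
  qed
  have facet: "F i facet_of P" if "i \<le> n" for i
    using facets(2)[of "i - 1"] facets(1)[of 0] that n by (cases i) auto

  define \<tau> where "\<tau> i = T i * s" for i
  have \<tau>_less: "\<tau> i < \<tau> (Suc i)" if "i \<le> n" for i
    using T_less[OF that] s by (simp add: \<tau>_def)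
  have step_\<tau>: "x (Suc i) = x i + (\<tau> (Suc i) - \<tau> i) *\<^sub>R (d i /\<^sub>R s)" if "i \<le> n" for i
    using step[OF that] s by (simp add: \<tau>_def flip: left_diff_distrib)
  obtain \<gamma> where cont: "continuous_on {\<tau> 0..\<tau> (Suc n)} \<gamma>"
    and \<gamma>: "\<And>i t. i \<le> n \<Longrightarrow> t \<in> {\<tau> i..\<tau> (Suc i)} \<Longrightarrow> \<gamma> t = x i + (t - \<tau> i) *\<^sub>R (d i /\<^sub>R s)"
    using piecewise_linear_path[of n \<tau> x "\<lambda>i. d i /\<^sub>R s", OF \<tau>_less step_\<tau>] by auto
  have \<tau>0: "\<tau> 0 = 0" by (simp add: \<tau>_def T0)
  have \<gamma>_node: "\<gamma> (\<tau> i) = x i" if "i \<le> n" for i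
    using \<gamma>[OF that, of "\<tau> i"] \<tau>_less[OF that] by simp
  have \<gamma>_end: "\<gamma> (\<tau> (Suc n)) = x (Suc n)"
    using \<gamma>[of n "\<tau> (Suc n)"] \<tau>_less[of n] step_\<tau>[of n] by simp
  have \<gamma>_segment: "\<gamma> t \<in> closed_segment (x i) (x (Suc i)) \<and>
      (\<tau> i < t \<longrightarrow> t < \<tau> (Suc i) \<longrightarrow> \<gamma> t \<in> open_segment (x i) (x (Suc i)))"
    if "i \<le> n" "t \<in> {\<tau> i..\<tau> (Suc i)}" for i t
  proof -
    define l where "l = \<tau> (Suc i) - \<tau> i"
    define u where "u = (t - \<tau> i) / l"
    have l: "l > 0" using \<tau>_less[OF that(1)] by (simp add: l_def)
    have "\<gamma> t = x i + u *\<^sub>R (x (Suc i) - x i)"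
      using \<gamma>[OF that] step_\<tau>[OF that(1)] l by (simp add: u_def flip: l_def)
    then have eq: "\<gamma> t = (1 - u) *\<^sub>R x i + u *\<^sub>R x (Suc i)"
      by (simp add: algebra_simps)
    moreover have "x i \<noteq> x (Suc i)"
      using step_\<tau>[OF that(1)] l s d_nz[OF that(1)] by (auto simp flip: l_def)
    moreover have "0 \<le> u" "u \<le> 1" "\<tau> i < t \<Longrightarrow> 0 < u" "t < \<tau> (Suc i) \<Longrightarrow> u < 1"
      using that l by (auto simp: u_def l_def)
    ultimately show ?thesis
      by (auto simp: in_segment)
  qed
  have \<gamma>F: "\<gamma> t \<in> F i" if "i \<le> n" "t \<in> {\<tau> i..\<tau> (Suc i)}" for i t
    using \<gamma>_segment[OF that] closed_segment_subset[OF xF[OF that(1)] xF'[OF that(1)] convF] by auto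

  define \<phi> where "\<phi> i = unfolding_chart (N i) (d i) (x i) (\<tau> i)" for i
  have \<phi>_Suc: "\<phi> i = unfolding_chart (N i) (d i) (x (Suc i)) (\<tau> (Suc i))" if "i \<le> n" for i
  proof -
    have "\<tau> (Suc i) = \<tau> i + (T (Suc i) - T i) * norm (d i)"
      by (simp add: \<tau>_def norm_d[OF that] algebra_simps)
    then show ?thesis
      using unfolding_chart_rebase[OF d_nz[OF that], of "N i" "x i" "T (Suc i) - T i" "\<tau> i"]
      by (simp add: \<phi>_def step[OF that])
  qed
  have crossing: "(\<forall>y\<in>F i \<inter> F (Suc i). \<phi> i y = \<phi> (Suc i) y) \<and>
      opposite_sides (affine hull (\<phi> (Suc i) ` (F i \<inter> F (Suc i)))) (\<phi> i ` F i) (\<phi> (Suc i) ` F (Suc i)) \<and>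
      x (Suc i) \<in> rel_interior (F i \<inter> F (Suc i))"
    if "i < n" for i
  proof -
    obtain \<alpha> where \<alpha>: "d (Suc i) = d i - \<alpha> *\<^sub>R (N i + N (Suc i))" using bend[OF \<open>i < n\<close>] ..
    have tan: "N i \<bullet> d i = 0" "N (Suc i) \<bullet> d (Suc i) = 0" using tangent that by auto
    have dim: "aff_dim (F i \<inter> F (Suc i)) = 1" using facets(3)[OF that] by (simp add: edge_of_def)
    have "\<phi> (Suc i) y = \<phi> i y" if y: "y \<in> F i \<inter> F (Suc i)" for y
      using \<phi>_Suc[of i] unfolding_charts_agree[OF norm_N[OF \<open>i < n\<close>] tan \<alpha> towards[OF \<open>i < n\<close>]]
        y xE[OF \<open>i < n\<close>] \<open>i < n\<close>
      by (simp add: \<phi>_def F_def inner_diff_right)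
    moreover have "opposite_sides (affine hull (\<phi> (Suc i) ` (F i \<inter> F (Suc i))))
        (\<phi> i ` F i) (\<phi> (Suc i) ` F (Suc i))"
      using \<phi>_Suc[of i] that support
        opposite_sides_unfolding_charts[OF norm_N[OF that] tan \<alpha> towards[OF that] _ _ order_refl xE[OF that] dim, where c = c]
      by (simp add: \<phi>_def F_def subset_eq)
    moreover have "x (Suc i) \<in> rel_interior (F i \<inter> F (Suc i))"
      using rel_interior_of_edge[OF _ dim abF(1,2)[OF that] x[OF that]] convF by (simp add: convex_Int)
    ultimately show ?thesis by auto
  qed

  have "unfolds_to_line P (\<tau> (Suc n)) \<gamma>"
    unfolding unfolds_to_line_def
  proof (intro exI conjI)
    show "\<forall>i\<le>n. F i facet_of P" using facet by blast
    show "\<forall>i\<in>{1..n}. F (i - 1) \<noteq> F i \<and> (F (i - 1) \<inter> F i) edge_of P \<and> F (i - 1) \<inter> F i \<subseteq> F (i - 1) \<inter> F i"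
    proof
      fix i assume "i \<in> {1..n}"
      then obtain j where "i = Suc j" "j < n" by (cases i) auto
      then show "F (i - 1) \<noteq> F i \<and> (F (i - 1) \<inter> F i) edge_of P \<and> F (i - 1) \<inter> F i \<subseteq> F (i - 1) \<inter> F i"
        using F_neq facets(3) by simp
    qed
    show "\<tau> 0 = 0" by (fact \<tau>0)
    show "\<tau> (n + 1) = \<tau> (Suc n)" by simp
    show "\<forall>i\<le>n. \<tau> i < \<tau> (i + 1)" using \<tau>_less by simp
    show "\<forall>i\<le>n. isometric_on (F i) (\<phi> i)"
      using isometric_on_unfolding_chart[OF tangent N_nz d_nz, of _ c] unfolding \<phi>_def F_def isometric_on_def
      by blast
    show "\<forall>i\<in>{1..n}. (\<forall>x\<in>F (i - 1) \<inter> F i. \<phi> (i - 1) x = \<phi> i x) \<and>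
        opposite_sides (affine hull (\<phi> i ` (F (i - 1) \<inter> F i))) (\<phi> (i - 1) ` F (i - 1)) (\<phi> i ` F i)"
    proof
      fix i assume "i \<in> {1..n}"
      then obtain j where "i = Suc j" "j < n" by (cases i) auto
      then show "(\<forall>x\<in>F (i - 1) \<inter> F i. \<phi> (i - 1) x = \<phi> i x) \<and>
        opposite_sides (affine hull (\<phi> i ` (F (i - 1) \<inter> F i))) (\<phi> (i - 1) ` F (i - 1)) (\<phi> i ` F i)"
        using crossing[of j] by simp
    qed
    show "\<forall>i\<le>n. \<gamma> ` {\<tau> i..\<tau> (i + 1)} \<subseteq> F i" using \<gamma>F by auto
    show "\<forall>i\<in>{1..n}. \<gamma> (\<tau> i) \<in> rel_interior (F (i - 1) \<inter> F i)"
    proof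
      fix i assume "i \<in> {1..n}"
      then obtain j where "i = Suc j" "j < n" by (cases i) auto
      then show "\<gamma> (\<tau> i) \<in> rel_interior (F (i - 1) \<inter> F i)"
        using crossing[of j] \<gamma>_node[of i] by simp
    qed
    show "norm (axis 1 1 :: real^2) = 1" by simp
    show "\<forall>i\<le>n. \<forall>t\<in>{\<tau> i..\<tau> (i + 1)}. \<phi> i (\<gamma> t) = 0 + t *\<^sub>R axis 1 1"
    proof (intro allI impI ballI)
      fix i t assume i: "i \<le> n" and "t \<in> {\<tau> i..\<tau> (i + 1)}"
      then have "\<gamma> t = x i + ((t - \<tau> i) / s) *\<^sub>R d i" using \<gamma>[OF i, of t] by (simp add: divide_inverse)
      moreover have "\<phi> i = unfolding_chart (N i) (d i) (x i + ((t - \<tau> i) / s) *\<^sub>R d i) t"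
        using unfolding_chart_rebase[OF d_nz[OF i], of "N i" "x i" "(t - \<tau> i) / s" "\<tau> i"] norm_d[OF i] s
        by (simp add: \<phi>_def)
      ultimately have "\<phi> i (\<gamma> t) = vector [t, 0]" by (simp add: unfolding_chart_base)
      then show "\<phi> i (\<gamma> t) = 0 + t *\<^sub>R axis 1 1"
        by (simp add: vec_eq_iff forall_2 axis_def)
    qed
  qed
  moreover have covered: "\<exists>i\<le>n. t \<in> {\<tau> i..\<tau> (Suc i)}"
    if "t \<in> {0..\<tau> (Suc n)}" for t
  proof (cases "t = \<tau> (Suc n)")
    case True
    then show ?thesis using \<tau>_less[of n] by auto
  next
    case False
    then have "\<tau> 0 \<le> t" "t < \<tau> (Suc n)" using that \<tau>0 by auto
    then obtain i where "i \<le> n" "\<tau> i \<le> t" "t < \<tau> (Suc i)" by (rule covering_interval)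
    then show ?thesis by force
  qed
  moreover have "\<gamma> ` {0..\<tau> (Suc n)} \<subseteq> frontier P"
  proof clarify
    fix t assume "t \<in> {0..\<tau> (Suc n)}"
    then obtain i where i: "i \<le> n" "\<gamma> t \<in> F i" using covered \<gamma>F by blast
    have "F i face_of P" "F i \<noteq> P"
      using facet[OF i(1)] by (auto simp: facet_of_def)
    then have "\<gamma> t \<notin> rel_interior P"
      using face_of_subset_rel_boundary i(2) by blast
    then show "\<gamma> t \<in> frontier P"
      using i(2) interior_subset_rel_interior[of P] closure_subset[of P] by (auto simp: frontier_def F_def)
  qed
  moreover have "\<not> \<gamma> t extreme_point_of P" if "0 < t" "t < \<tau> (Suc n)" for t
  proof -
    have "\<tau> 0 \<le> t" using that \<tau>0 by simp
    then obtain i where i: "i \<le> n" "\<tau> i \<le> t" "t < \<tau> (Suc i)"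
      using \<open>t < \<tau> (Suc n)\<close> by (rule covering_interval)
    show ?thesis
    proof (cases "t = \<tau> i")
      case True
      then have "i \<noteq> 0" using \<tau>0 \<open>0 < t\<close> by (auto intro: ccontr)
      then obtain j where "i = Suc j" "j < n" using i(1) by (cases i) auto
      then show ?thesis
        using \<gamma>_node[OF i(1)] True x[of j] a[of j] b[of j] unfolding extreme_point_of_def by metis
    next
      case False
      then have "\<gamma> t \<in> open_segment (x i) (x (Suc i))" using \<gamma>_segment[of i t] i by auto
      then show ?thesis using xF[OF i(1)] xF'[OF i(1)] by (auto simp: extreme_point_of_def F_def)
    qed
  qed
  moreover have "\<tau> (Suc n) > 0"
  proof -
    have "0 \<le> \<tau> i" if "i \<le> n" for i
      using that
    proof (induction i)
      case (Suc i)
      then show ?case using \<tau>_less[of i] by simp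
    qed (simp add: \<tau>0)
    from this[of n] \<tau>_less[of n] show ?thesis by simp
  qed
  ultimately show ?thesis
    using cont \<gamma>_node[of 0] \<gamma>_end \<tau>0 unfolding straight_line_trajectory_def
    by (intro exI[of _ "\<tau> (Suc n)"] exI[of _ \<gamma>] conjI) auto
qed

section \<open>The dodecahedron\<close>

lemma golden_sq: "golden * golden = golden + 1"
  by (simp add: golden_def field_simps)

lemma golden_sq_mult: "golden * (golden * r) = r + golden * r"
  by (simp add: golden_sq distrib_right flip: mult.assoc)

lemma golden_bounds: "1.61 < golden" "golden < 1.62"
proof -
  have "2.22 < sqrt 5" by (rule real_less_rsqrt) (simp add: power2_eq_square)
  moreover have "sqrt 5 < 2.24" by (rule real_less_lsqrt) (simp_all add: power2_eq_square)
  ultimately show "1.61 < golden" "golden < 1.62" by (simp_all add: golden_def)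
qed

lemma divide_golden: "b / golden = b * (golden - 1)"
proof -
  have "golden \<noteq> 0" using golden_bounds by simp
  moreover have "(golden - 1) * golden = 1" by (simp add: golden_sq left_diff_distrib)
  ultimately show ?thesis by (simp add: nonzero_divide_eq_eq mult.assoc)
qed

lemma dodecahedron_vertexE:
  assumes "v \<in> dodecahedron_vertices"
  obtains (cube) a b c where "v = vector [a, b, c]" "a \<in> {-1, 1}" "b \<in> {-1, 1}" "c \<in> {-1, 1}"
  | (yz) a b where "v = vector [0, a * golden, b * (golden - 1)]" "a \<in> {-1, 1}" "b \<in> {-1, 1}"
  | (xz) a b where "v = vector [b * (golden - 1), 0, a * golden]" "a \<in> {-1, 1}" "b \<in> {-1, 1}"
  | (xy) a b where "v = vector [a * golden, b * (golden - 1), 0]" "a \<in> {-1, 1}" "b \<in> {-1, 1}"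
  using assms unfolding dodecahedron_vertices_def divide_golden by blast

lemma signed_vertex_in_dodecahedron:
  assumes "a \<in> {-1, 1}" "b \<in> {-1, 1}" "c \<in> {-1, 1}"
  shows "vector [a, b, c] \<in> dodecahedron"
    "vector [0, a * golden, b * (golden - 1)] \<in> dodecahedron"
    "vector [b * (golden - 1), 0, a * golden] \<in> dodecahedron"
    "vector [a * golden, b * (golden - 1), 0] \<in> dodecahedron"
  unfolding dodecahedron_def
  by (rule hull_inc, use assms in \<open>simp only: dodecahedron_vertices_def divide_golden, blast\<close>)+

lemma norm_dodecahedron_vertex:
  assumes "v \<in> dodecahedron_vertices"
  shows "norm v = sqrt 3"
  using assms
proof (cases rule: dodecahedron_vertexE)
qed (auto simp: norm_eq_sqrt_inner inner_vec_def sum_3 algebra_simps golden_sq)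

text \<open>A ball is strictly convex, so a point of the set at maximal distance from the centre is extreme.\<close>

lemma extreme_point_of_sphere:
  fixes v :: "'a::euclidean_space"
  assumes "v \<in> S" "S \<subseteq> cball 0 (norm v)"
  shows "v extreme_point_of S"
  unfolding extreme_point_of_def
proof (intro conjI ballI notI)
  fix a b assume "a \<in> S" "b \<in> S" "v \<in> open_segment a b"
  then show False
    using dist_decreases_open_segment[of v a b 0] assms(2) by force
qed (fact assms(1))

lemma vertex_extreme_point_of_dodecahedron:
  assumes "v \<in> dodecahedron_vertices"
  shows "v extreme_point_of dodecahedron"
proof (rule extreme_point_of_sphere)
  show "v \<in> dodecahedron" unfolding dodecahedron_def using assms by (rule hull_inc)
  show "dodecahedron \<subseteq> cball 0 (norm v)"
    unfolding dodecahedron_def norm_dodecahedron_vertex[OF assms]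
    by (rule hull_minimal) (auto simp: norm_dodecahedron_vertex)
qed

lemma dodecahedron_support:
  assumes N: "\<And>v. v \<in> dodecahedron_vertices \<Longrightarrow> N \<bullet> v \<le> c" and "y \<in> dodecahedron"
  shows "N \<bullet> y \<le> c"
proof -
  have "dodecahedron \<subseteq> {y. N \<bullet> y \<le> c}"
    unfolding dodecahedron_def using N by (intro hull_minimal) (auto simp: convex_halfspace_le)
  then show ?thesis using assms(2) by auto
qed

section \<open>The closed trajectory through seven faces\<close>

text \<open>The normals of the seven faces in the order in which they are met. Every face lies in the plane
  \<open>N \<bullet> y = golden + 1\<close> of its normal \<open>N\<close>.\<close>

definition face_normal :: "nat \<Rightarrow> real^3" where
  "face_normal i = [vector [1, golden, 0],
    vector [0, 1, golden],
    vector [0, -1, golden],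
    vector [-1, - golden, 0],
    vector [- golden, 0, -1],
    vector [0, -1, - golden],
    vector [0, 1, - golden]] ! i"

text \<open>Only the first entry is a choice: it is the displacement from the starting corner to the other copy
  of its vertex after unfolding the seven faces into the plane of the first. Each further entry
  is the previous one plus the multiple of the two normals that makes it tangent to the next face.
  The common length of these vectors is the length of the trajectory.\<close>

definition direction :: "nat \<Rightarrow> real^3" where
  "direction i = [vector [- golden, 1, 5 + 3 * golden],
    vector [- 3 * golden, - 4 * golden - 1, 3 + golden],
    vector [- 3 * golden, - 4 * golden - 1, - golden - 3],
    vector [- golden, 1, - 3 * golden - 5],
    vector [3 + golden, 3 * golden, - 4 * golden - 1],
    vector [2 + 3 * golden, 3 + 2 * golden, 1 - 3 * golden],
    vector [2 + 3 * golden, 3 + 2 * golden, 3 * golden - 1]] ! i"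

definition node :: "nat \<Rightarrow> real^3" where
  "node i = [vector [1, 1, -1],
    vector [(3 - golden) / 2, (4 - golden) / 2, (5 - 2 * golden) / 2],
    vector [(5 * golden - 9) / 11, 0, golden],
    vector [(- golden) / 2, (1 - 2 * golden) / 2, (3 * golden - 3) / 2],
    vector [(- 5 * golden - 4) / 11, (1 - 7 * golden) / 11, (- 2 * golden - 6) / 11],
    vector [(2 - 4 * golden) / 5, (- golden - 2) / 5, (- 3 * golden - 1) / 5],
    vector [(7 - 5 * golden) / 11, 0, - golden],
    vector [1, 1, -1]] ! i"

text \<open>Times are measured as fractions of the length of the trajectory.\<close>

definition node_time :: "nat \<Rightarrow> real" where
  "node_time i = [0, (2 - golden) / 2, (3 * golden - 1) / 11, 1 / 2, (1 + 4 * golden) / 11,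
    (2 + golden) / 5, (6 + 2 * golden) / 11, 1] ! i"

text \<open>The factors \<open>\<alpha>\<close> by which the directions bend along the sum of the two normals.\<close>

definition bend_amount :: "nat \<Rightarrow> real" where
  "bend_amount i =
    [2 * golden, 3 * golden - 2, 2 * golden, 4 - golden, 3 - golden, 4 - golden] ! i"

definition edge_start :: "nat \<Rightarrow> real^3" where
  "edge_start i = [vector [0, golden, golden - 1],
    vector [1 - golden, 0, golden],
    vector [-1, -1, 1],
    vector [-1, -1, -1],
    vector [1 - golden, 0, - golden],
    vector [1 - golden, 0, - golden]] ! i"

definition edge_end :: "nat \<Rightarrow> real^3" where
  "edge_end i = [vector [1, 1, 1],
    vector [golden - 1, 0, golden],
    vector [0, - golden, golden - 1],
    vector [- golden, 1 - golden, 0],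
    vector [-1, -1, -1],
    vector [golden - 1, 0, - golden]] ! i"

text \<open>The position of each crossing point on its edge, as a fraction of the way from \<open>edge_start\<close> to
  \<open>edge_end\<close>.\<close>

definition edge_ratio :: "nat \<Rightarrow> real" where
  "edge_ratio i = [(3 - golden) / 2, (8 - 2 * golden) / 11, (2 - golden) / 2,
    (5 - 2 * golden) / 11, (2 + golden) / 5, (3 + golden) / 11] ! i"

lemmas path_data = face_normal_def direction_def node_def node_time_def bend_amount_def
  edge_start_def edge_end_def edge_ratio_def

lemmas golden_inner = inner_vec_def sum_3 algebra_simps golden_sq golden_sq_mult

lemmas golden_vector = vec_eq_iff forall_3 algebra_simps golden_sq golden_sq_mult

lemma cases_less_6: "i < 6 \<Longrightarrow> i = 0 \<or> i = 1 \<or> i = 2 \<or> i = 3 \<or> i = 4 \<or> i = (5::nat)"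
  by linarith

lemma cases_le_6: "i \<le> 6 \<Longrightarrow> i = 0 \<or> i = 1 \<or> i = 2 \<or> i = 3 \<or> i = 4 \<or> i = 5 \<or> i = (6::nat)"
  by linarith

lemma face_normal_support:
  assumes "i \<le> 6" "v \<in> dodecahedron_vertices"
  shows "face_normal i \<bullet> v \<le> golden + 1"
  using assms(2)
proof (cases rule: dodecahedron_vertexE)
qed (use cases_le_6[OF assms(1)] golden_bounds in \<open>auto simp: path_data golden_inner\<close>)

lemma norm_face_normal: "i \<le> 6 \<Longrightarrow> norm (face_normal i) = sqrt (golden + 2)"
  by (drule cases_le_6) (auto simp: path_data norm_eq_sqrt_inner golden_inner)

lemma direction_tangent: "i \<le> 6 \<Longrightarrow> face_normal i \<bullet> direction i = 0"
  by (drule cases_le_6) (auto simp: path_data golden_inner)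

lemma direction_bends:
  "i < 6 \<Longrightarrow> direction (Suc i) =
    direction i - bend_amount i *\<^sub>R (face_normal i + face_normal (Suc i))"
  by (drule cases_less_6) (auto simp: path_data golden_vector)

lemma direction_towards: "i < 6 \<Longrightarrow> face_normal (Suc i) \<bullet> direction i > 0"
  using golden_bounds by (drule_tac cases_less_6) (auto simp: path_data golden_inner)

lemma node_time_increasing: "i \<le> 6 \<Longrightarrow> node_time i < node_time (Suc i)"
  using golden_bounds by (drule_tac cases_le_6) (auto simp: path_data)

lemma node_step:
  "i \<le> 6 \<Longrightarrow> node (Suc i) = node i + (node_time (Suc i) - node_time i) *\<^sub>R direction i"
  by (drule cases_le_6) (auto simp: path_data golden_vector field_simps)

lemma edge_ends_in_dodecahedron:
  "i < 6 \<Longrightarrow> edge_start i \<in> dodecahedron \<and> edge_end i \<in> dodecahedron"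
  using signed_vertex_in_dodecahedron[of 1 1 1] signed_vertex_in_dodecahedron[of "-1" "-1" 1]
    signed_vertex_in_dodecahedron[of "-1" "-1" "-1"] signed_vertex_in_dodecahedron[of 1 "-1" 1]
    signed_vertex_in_dodecahedron[of "-1" 1 1]
  by (drule_tac cases_less_6) (auto simp: path_data)

lemma edge_ends_in_face_planes:
  assumes "i < 6"
  shows "face_normal i \<bullet> edge_start i = golden + 1" "face_normal (Suc i) \<bullet> edge_start i = golden + 1"
    "face_normal i \<bullet> edge_end i = golden + 1" "face_normal (Suc i) \<bullet> edge_end i = golden + 1"
  using cases_less_6[OF assms] by (auto simp: path_data golden_inner)

lemma node_inside_edge:
  assumes "i < 6"
  shows "node (Suc i) \<in> open_segment (edge_start i) (edge_end i)"
proof -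
  have "edge_start i \<noteq> edge_end i"
    using cases_less_6[OF assms] golden_bounds by (auto simp: path_data vec_eq_iff forall_3)
  moreover have "0 < edge_ratio i" "edge_ratio i < 1"
    using cases_less_6[OF assms] golden_bounds by (auto simp: path_data)
  moreover have "node (Suc i) = (1 - edge_ratio i) *\<^sub>R edge_start i + edge_ratio i *\<^sub>R edge_end i"
    using cases_less_6[OF assms] by (auto simp: path_data golden_vector field_simps)
  ultimately show ?thesis by (auto simp: in_segment)
qed

theorem theorem1:
  "\<exists>(v :: real^3) (L :: real) (\<gamma> :: real \<Rightarrow> real^3).
     v extreme_point_of dodecahedron \<and> L > 0 \<and>
     straight_line_trajectory dodecahedron L \<gamma> \<and>
     \<gamma> 0 = v \<and> \<gamma> L = v \<and>
     (\<forall>t. 0 < t \<and> t < L \<longrightarrow> \<not> \<gamma> t extreme_point_of dodecahedron)"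
proof -
  let ?v = "vector [1, 1, -1] :: real^3"
  have v: "?v \<in> dodecahedron_vertices"
    unfolding dodecahedron_vertices_def by blast
  have ends: "node 0 = ?v" "node (Suc 6) = ?v" by (simp_all add: node_def)
  have "\<exists>L \<gamma>. L > 0 \<and> straight_line_trajectory dodecahedron L \<gamma> \<and>
      \<gamma> 0 = node 0 \<and> \<gamma> L = node (Suc 6) \<and>
      (\<forall>t. 0 < t \<and> t < L \<longrightarrow> \<not> \<gamma> t extreme_point_of dodecahedron)"
  proof (rule bending_polygon_is_trajectory)
    show "0 < (6::nat)" by simp
    show "convex dodecahedron" by (simp add: dodecahedron_def)
    show "face_normal i \<bullet> y \<le> golden + 1" if "i \<le> 6" "y \<in> dodecahedron" for i y
      using dodecahedron_support[OF face_normal_support] that by blast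
    show "norm (face_normal (Suc i)) = norm (face_normal i)" if "i < 6" for i
      using that by (simp add: norm_face_normal)
    show "\<exists>\<alpha>. direction (Suc i) = direction i - \<alpha> *\<^sub>R (face_normal i + face_normal (Suc i))"
      if "i < 6" for i using direction_bends[OF that] by blast
    show "node 0 \<in> dodecahedron" "node (Suc 6) \<in> dodecahedron"
      unfolding ends dodecahedron_def using v by (simp_all add: hull_inc)
    show "face_normal 0 \<bullet> node 0 = golden + 1" by (simp add: path_data golden_inner)
    show "node_time 0 = 0" by (simp add: node_time_def)
    show "edge_start i \<in> dodecahedron \<and> face_normal i \<bullet> edge_start i = golden + 1 \<and>
        face_normal (Suc i) \<bullet> edge_start i = golden + 1"
      "edge_end i \<in> dodecahedron \<and> face_normal i \<bullet> edge_end i = golden + 1 \<and>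
        face_normal (Suc i) \<bullet> edge_end i = golden + 1" if "i < 6" for i
      using edge_ends_in_dodecahedron[OF that] edge_ends_in_face_planes[OF that] by auto
  qed (fact direction_tangent direction_towards node_time_increasing node_step node_inside_edge)+
  then show ?thesis
    unfolding ends using vertex_extreme_point_of_dodecahedron[OF v] by blast
qed

end
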